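(* Let $G$ be a group generated by elements $g_1,\dots,g_m$ such that $g_i^2=1$ for all $i=1,\dots,m$. For $k\ge 2$ consider the map $$h:\gamma_k(G)/\gamma_{k+1}(G)\to\gamma_{k+1}(G)/\gamma_{k+2}(G),\qquad a\,\gamma_{k+1}(G)\mapsto a^2\,\gamma_{k+2}(G).$$ Then: (1) $h:L_k(G)\to L_{k+1}(G)$ is a well-defined linear map for every $k\ge 2$; (2) $[x,h(y)]=h([x,y])$ for all $x\in L_k(G)$, $y\in L_\ell(G)$ with $k\ge 1$, $\ell\ge 2$; (3) $h([\overline{g}_i,y])=[\overline{g}_i,h(y)]$ for all $i=1,\dots,m$ and $y\in L_\ell(G)$, $\ell\ge 2$; (4) $h([\overline{g}_i,\overline{g}_j])=[\overline{g}_i,[\overline{g}_i,\overline{g}_j]]$ for all $i,j\in\{1,\dots,m\}$.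
   Context: For a group $G$, the commutator is $(a,b)=a^{-1}b^{-1}ab$. The lower central series is $\gamma_1(G)=G$, $\gamma_{k+1}(G)=(\gamma_k(G),G)$ (the subgroup generated by commutators). Put $L_k(G)=\gamma_k(G)/\gamma_{k+1}(G)$ (an abelian group, written additively) and $L(G)=\bigoplus_{k\ge1}L_k(G)$; this is a graded Lie ring with bracket $[\overline{a},\overline{b}]=\overline{(a,b)}\in L_{k+\ell}(G)$ for $a\in\gamma_k(G)$, $b\in\gamma_\ell(G)$, where $\overline{a}$ denotes the class of $a\in\gamma_k(G)$ in $L_k(G)$. In particular $\overline{g}_i\in L_1(G)$ is the class of $g_i$. Well-definedness of $h$ includes the fact that $a^2\in\gamma_{k+1}(G)$ for $a\in\gamma_k(G)$. *)

theory Defs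
  imports "HOL-Algebra.Coset" "HOL-Algebra.Generated_Groups"
begin

definition group_comm :: "('a, 'b) monoid_scheme \<Rightarrow> 'a \<Rightarrow> 'a \<Rightarrow> 'a" where
  "group_comm G a b = inv\<^bsub>G\<^esub> a \<otimes>\<^bsub>G\<^esub> inv\<^bsub>G\<^esub> b \<otimes>\<^bsub>G\<^esub> a \<otimes>\<^bsub>G\<^esub> b"

definition comm_subgroup :: "('a, 'b) monoid_scheme \<Rightarrow> 'a set \<Rightarrow> 'a set \<Rightarrow> 'a set" where
  "comm_subgroup G H K = generate G {group_comm G a b | a b. a \<in> H \<and> b \<in> K}"

text \<open>The series is indexed from 1; the value at index 0 is a dummy.\<close>

fun lower_central :: "('a, 'b) monoid_scheme \<Rightarrow> nat \<Rightarrow> 'a set" where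
  "lower_central G 0 = carrier G"
| "lower_central G (Suc 0) = carrier G"
| "lower_central G (Suc (Suc k)) = comm_subgroup G (lower_central G (Suc k)) (carrier G)"

text \<open>The abelian group \<open>L\<^sub>k(G)\<close>. As a library quotient group it is written multiplicatively,
  and its elements are right cosets, which agree with the left cosets since all terms of the lower
  central series are normal. Additive maps between these groups are the elements of \<^const>\<open>hom\<close>.\<close>

definition lie_comp :: "('a, 'b) monoid_scheme \<Rightarrow> nat \<Rightarrow> 'a set monoid" where
  "lie_comp G k = (G\<lparr>carrier := lower_central G k\<rparr>) Mod lower_central G (Suc k)"

definition lie_class :: "('a, 'b) monoid_scheme \<Rightarrow> nat \<Rightarrow> 'a \<Rightarrow> 'a set" where
  "lie_class G k a = lower_central G (Suc k) #>\<^bsub>G\<^esub> a"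

text \<open>Maps on classes are defined by applying the defining formula to all representatives; the
  result is meaningful exactly if all representatives yield the same class. The bracket is given on
  homogeneous elements, with \<open>X\<close> in \<open>L\<^sub>k(G)\<close> and \<open>Y\<close> in \<open>L\<^sub>l(G)\<close>.\<close>

definition lie_bracket ::
  "('a, 'b) monoid_scheme \<Rightarrow> nat \<Rightarrow> nat \<Rightarrow> 'a set \<Rightarrow> 'a set \<Rightarrow> 'a set" where
  "lie_bracket G k l X Y =
     the_elem ((\<lambda>(a, b). lie_class G (k + l) (group_comm G a b)) ` (X \<times> Y))"

definition square_map :: "('a, 'b) monoid_scheme \<Rightarrow> nat \<Rightarrow> 'a set \<Rightarrow> 'a set" where
  "square_map G k X = the_elem ((\<lambda>a. lie_class G (Suc k) (a [^]\<^bsub>G\<^esub> (2::nat))) ` X)"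

end

theory Submission
  imports Defs
begin

text \<open>Everything rests on \<open>(\<gamma>\<^sub>k, \<gamma>\<^sub>l) \<subseteq> \<gamma>\<^bsub>k+l\<^esub>\<close>, a consequence of the Hall-Witt identity.
  Squares of elements of \<open>G\<close> lie in \<open>\<gamma>\<^sub>2\<close>, because \<open>G / \<gamma>\<^sub>2\<close> is abelian and generated by
  involutions. Modulo \<open>\<gamma>\<^bsub>k+2\<^esub>\<close> the square of a commutator \<open>(a, b)\<close> with \<open>a \<in> \<gamma>\<^sub>k\<close> is \<open>(a, b\<^sup>2)\<close>,
  so squaring maps \<open>\<gamma>\<^bsub>k+1\<^esub>\<close> into \<open>\<gamma>\<^bsub>k+2\<^esub>\<close>. The remaining claims follow from
  \<open>(ab)\<^sup>2 = a\<^sup>2b\<^sup>2\<close> up to a conjugate of \<open>(b\<^sup>-\<^sup>1, a\<^sup>-\<^sup>1)\<close>, from \<open>(a, b\<^sup>2) = (a, b)\<^sup>2\<close> up to a conjugate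
  of \<open>(b, (a, b)\<^sup>-\<^sup>1)\<close>, and from \<open>(x, (x, y)) = (x, y)\<^sup>2\<close> for involutions \<open>x\<close>, \<open>y\<close>.\<close>

context group
begin

section \<open>Word identities for commutators and squares\<close>

lemma mult_inv_cancel_left:
  assumes "x \<in> carrier G" "y \<in> carrier G"
  shows "x \<otimes> (inv x \<otimes> y) = y" and "inv x \<otimes> (x \<otimes> y) = y"
  using assms by (simp_all flip: m_assoc)

text \<open>Associating to the right, moving inverses onto letters and cancelling neighbours is free
  reduction, so simp proves word identities valid in every group.\<close>

lemmas group_word_simps = m_assoc inv_mult_group mult_inv_cancel_left

lemma pow_two: "x \<in> carrier G \<Longrightarrow> x [^] (2::nat) = x \<otimes> x"
  by (simp add: numeral_2_eq_2)

lemma group_comm_closed [simp, intro]: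
  "a \<in> carrier G \<Longrightarrow> b \<in> carrier G \<Longrightarrow> group_comm G a b \<in> carrier G"
  by (simp add: group_comm_def)

lemma inv_group_comm:
  "a \<in> carrier G \<Longrightarrow> b \<in> carrier G \<Longrightarrow> inv (group_comm G a b) = group_comm G b a"
  by (simp add: group_comm_def group_word_simps)

lemma group_comm_mult_left:
  assumes "a \<in> carrier G" "b \<in> carrier G" "c \<in> carrier G"
  shows "group_comm G (a \<otimes> b) c = inv b \<otimes> group_comm G a c \<otimes> b \<otimes> group_comm G b c"
  using assms by (simp add: group_comm_def group_word_simps)

lemma group_comm_mult_right:
  assumes "a \<in> carrier G" "b \<in> carrier G" "c \<in> carrier G"
  shows "group_comm G a (b \<otimes> c) = group_comm G a c \<otimes> (inv c \<otimes> group_comm G a b \<otimes> c)"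
  using assms by (simp add: group_comm_def group_word_simps)

lemma group_comm_inv_right:
  assumes "a \<in> carrier G" "b \<in> carrier G"
  shows "group_comm G a (inv b) = b \<otimes> inv (group_comm G a b) \<otimes> inv b"
  using assms by (simp add: group_comm_def group_word_simps)

lemma conj_group_comm:
  assumes "a \<in> carrier G" "b \<in> carrier G" "x \<in> carrier G"
  shows "x \<otimes> group_comm G a b \<otimes> inv x = group_comm G (x \<otimes> a \<otimes> inv x) (x \<otimes> b \<otimes> inv x)"
  using assms by (simp add: group_comm_def group_word_simps)

lemma Hall_Witt:
  assumes "a \<in> carrier G" "b \<in> carrier G" "c \<in> carrier G"
  shows "(inv b \<otimes> group_comm G (group_comm G a (inv b)) c \<otimes> b) \<otimes>
         (inv c \<otimes> group_comm G (group_comm G b (inv c)) a \<otimes> c) \<otimes>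
         (inv a \<otimes> group_comm G (group_comm G c (inv a)) b \<otimes> a) = \<one>"
  using assms by (simp add: group_comm_def group_word_simps)

text \<open>The correction stands on the left, as a conjugate, to fit right cosets and normal
  subgroups; likewise in \<open>group_comm_square_right\<close>.\<close>

lemma square_mult:
  assumes "a \<in> carrier G" "b \<in> carrier G"
  shows "(a \<otimes> b) [^] (2::nat) =
    a \<otimes> group_comm G (inv b) (inv a) \<otimes> inv a \<otimes> (a [^] (2::nat) \<otimes> b [^] (2::nat))"
  using assms by (simp add: group_comm_def pow_two group_word_simps)

lemma group_comm_square_right:
  assumes "a \<in> carrier G" "b \<in> carrier G"
  defines "c \<equiv> group_comm G a b"
  shows "group_comm G a (b [^] (2::nat)) = c \<otimes> group_comm G b (inv c) \<otimes> inv c \<otimes> c [^] (2::nat)"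
  using assms(1,2) unfolding c_def by (simp add: group_comm_def pow_two group_word_simps)

text \<open>Conjugation by \<open>x\<close> turns \<open>c = xyxy\<close> into \<open>yxyx\<close>,
  its inverse; hence \<open>inv x \<otimes> inv c \<otimes> x = c\<close>.\<close>

lemma group_comm_involutions:
  assumes "x \<in> carrier G" "y \<in> carrier G" "x [^] (2::nat) = \<one>" "y [^] (2::nat) = \<one>"
  shows "group_comm G x (group_comm G x y) = (group_comm G x y) [^] (2::nat)"
proof -
  have "inv x = x" "inv y = y"
    using assms by (simp_all add: pow_two inv_equality)
  then show ?thesis
    using assms by (simp add: group_comm_def pow_two group_word_simps)
qed

section \<open>Commutators and squares modulo a normal subgroup\<close>

lemma normal_conj:
  assumes "N \<lhd> G" "h \<in> N" "x \<in> carrier G"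
  shows "x \<otimes> h \<otimes> inv x \<in> N" "inv x \<otimes> h \<otimes> x \<in> N"
  using assms by (simp_all add: normal.inv_op_closed1 normal.inv_op_closed2)

lemma conj_mem_normalD:
  assumes "N \<lhd> G" "inv x \<otimes> h \<otimes> x \<in> N" "x \<in> carrier G" "h \<in> carrier G"
  shows "h \<in> N"
proof -
  have "x \<otimes> (inv x \<otimes> h \<otimes> x) \<otimes> inv x \<in> N"
    using assms normal_conj by blast
  then show ?thesis
    using assms by (simp add: group_word_simps)
qed

text \<open>Two of the three Hall-Witt factors are conjugates of elements of \<open>N\<close>, so
  the third factor lies in \<open>N\<close> as well.\<close>

lemma three_subgroups_elementwise:
  assumes N: "N \<lhd> G" and G: "a \<in> carrier G" "b \<in> carrier G" "c \<in> carrier G"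
    and "group_comm G (group_comm G a (inv b)) c \<in> N"
    and "group_comm G (group_comm G c (inv a)) b \<in> N"
  shows "group_comm G (group_comm G b (inv c)) a \<in> N"
proof -
  interpret N: normal N G by fact
  define u where "u = inv b \<otimes> group_comm G (group_comm G a (inv b)) c \<otimes> b"
  define v where "v = inv c \<otimes> group_comm G (group_comm G b (inv c)) a \<otimes> c"
  define w where "w = inv a \<otimes> group_comm G (group_comm G c (inv a)) b \<otimes> a"
  have uw: "u \<in> N" "w \<in> N"
    unfolding u_def w_def using assms by (simp_all add: normal_conj)
  have [simp]: "u \<in> carrier G" "v \<in> carrier G" "w \<in> carrier G"
    unfolding u_def v_def w_def using G by auto
  have "u \<otimes> v \<otimes> w = \<one>"
    unfolding u_def v_def w_def using Hall_Witt[OF G] .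
  then have "inv u \<otimes> (u \<otimes> v \<otimes> w) \<otimes> inv w = inv u \<otimes> inv w"
    by simp
  then have "v = inv u \<otimes> inv w"
    by (simp add: group_word_simps)
  then have "v \<in> N"
    using uw by simp
  then show ?thesis
    unfolding v_def by (rule conj_mem_normalD[OF N]) (use G in auto)
qed

text \<open>Lets \<open>(H, K) \<subseteq> N\<close> be checked on generators of \<open>K\<close>:
  expanding \<open>(a, bc)\<close> and \<open>(a, inv c)\<close> produces only conjugates, which
  \<open>N\<close> absorbs.\<close>

lemma subgroup_group_comm_right:
  assumes "H \<subseteq> carrier G" "N \<lhd> G"
  shows "subgroup {c \<in> carrier G. \<forall>a\<in>H. group_comm G a c \<in> N} G"
proof -
  interpret N: normal N G by fact
  show ?thesis
  proof (rule subgroupI)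
    show "{c \<in> carrier G. \<forall>a\<in>H. group_comm G a c \<in> N} \<noteq> {}"
      using assms(1) by (auto simp: group_comm_def subset_iff intro!: exI[of _ \<one>])
  next
    fix c assume c: "c \<in> {c \<in> carrier G. \<forall>a\<in>H. group_comm G a c \<in> N}"
    have "group_comm G a (inv c) \<in> N" if "a \<in> H" for a
      using that c assms by (simp add: group_comm_inv_right subset_iff normal_conj)
    then show "inv c \<in> {c \<in> carrier G. \<forall>a\<in>H. group_comm G a c \<in> N}"
      using c by simp
  next
    fix b c
    assume bc: "b \<in> {c \<in> carrier G. \<forall>a\<in>H. group_comm G a c \<in> N}"
               "c \<in> {c \<in> carrier G. \<forall>a\<in>H. group_comm G a c \<in> N}"
    have "group_comm G a (b \<otimes> c) \<in> N" if "a \<in> H" for a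
      using that bc assms by (simp add: group_comm_mult_right subset_iff normal_conj)
    then show "b \<otimes> c \<in> {c \<in> carrier G. \<forall>a\<in>H. group_comm G a c \<in> N}"
      using bc by simp
  qed auto
qed

text \<open>Elements of \<open>H\<close> commute modulo \<open>N\<close>, so squaring is a
  homomorphism from \<open>H\<close> into \<open>G / N\<close>; the set is its kernel. Thus squares
  need to be checked on generators only.\<close>

lemma subgroup_square_mem:
  assumes "subgroup H G" "N \<lhd> G" "\<And>a b. a \<in> H \<Longrightarrow> b \<in> H \<Longrightarrow> group_comm G a b \<in> N"
  shows "subgroup {c \<in> H. c [^] (2::nat) \<in> N} G"
proof -
  interpret H: subgroup H G by fact
  interpret N: normal N G by fact
  show ?thesis
  proof (rule subgroupI)
    show "{c \<in> H. c [^] (2::nat) \<in> N} \<noteq> {}"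
      by (auto intro!: exI[of _ \<one>])
  next
    fix c assume "c \<in> {c \<in> H. c [^] (2::nat) \<in> N}"
    then show "inv c \<in> {c \<in> H. c [^] (2::nat) \<in> N}"
      by (simp add: nat_pow_inv)
  next
    fix b c assume "b \<in> {c \<in> H. c [^] (2::nat) \<in> N}" "c \<in> {c \<in> H. c [^] (2::nat) \<in> N}"
    then show "b \<otimes> c \<in> {c \<in> H. c [^] (2::nat) \<in> N}"
      using assms by (simp add: square_mult normal_conj)
  qed auto
qed

section \<open>The lower central series\<close>

lemma lower_central_Suc:
  "k \<ge> 1 \<Longrightarrow> lower_central G (Suc k) = comm_subgroup G (lower_central G k) (carrier G)"
  by (cases k) auto

text \<open>Conjugating a commutator conjugates both entries, so the generating set is itself
  invariant.\<close>

lemma normal_comm_subgroup: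
  assumes "H \<lhd> G" "K \<lhd> G"
  shows "comm_subgroup G H K \<lhd> G"
  unfolding comm_subgroup_def
proof (rule normal_generateI)
  interpret H: normal H G by fact
  interpret K: normal K G by fact
  show "{group_comm G a b |a b. a \<in> H \<and> b \<in> K} \<subseteq> carrier G"
    by auto
  fix h x assume h: "h \<in> {group_comm G a b |a b. a \<in> H \<and> b \<in> K}" and x: "x \<in> carrier G"
  from h obtain a b where "h = group_comm G a b" "a \<in> H" "b \<in> K"
    by auto
  then have "x \<otimes> h \<otimes> inv x = group_comm G (x \<otimes> a \<otimes> inv x) (x \<otimes> b \<otimes> inv x)"
    and "x \<otimes> a \<otimes> inv x \<in> H" and "x \<otimes> b \<otimes> inv x \<in> K"
    using x assms by (simp_all add: conj_group_comm normal_conj)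
  then show "x \<otimes> h \<otimes> inv x \<in> {group_comm G a b |a b. a \<in> H \<and> b \<in> K}"
    by auto
qed

lemma normal_carrier: "carrier G \<lhd> G"
  by (simp add: normal_inv_iff subgroup_self)

lemma normal_lower_central: "lower_central G k \<lhd> G"
proof (induction k)
  case (Suc k)
  then show ?case
    by (cases k) (use normal_carrier normal_comm_subgroup in auto)
qed (simp add: normal_carrier)

declare lower_central.simps(3) [simp del]

lemma lower_central_subset: "lower_central G k \<subseteq> carrier G"
  by (rule subgroup.subset[OF normal_imp_subgroup[OF normal_lower_central]])

lemma lower_central_closed: "a \<in> lower_central G k \<Longrightarrow> a \<in> carrier G"
  using lower_central_subset by blast

lemma lower_central_inv: "a \<in> lower_central G k \<Longrightarrow> inv a \<in> lower_central G k"
  by (rule subgroup.m_inv_closed[OF normal_imp_subgroup[OF normal_lower_central]])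

lemma lower_central_Suc_subset: "lower_central G (Suc k) \<subseteq> lower_central G k"
proof (cases "k = 0")
  case False
  interpret H: normal "lower_central G k" G by (rule normal_lower_central)
  have "group_comm G a b \<in> lower_central G k" if "a \<in> lower_central G k" "b \<in> carrier G" for a b
  proof -
    have "group_comm G a b = inv a \<otimes> (inv b \<otimes> a \<otimes> b)"
      using that by (simp add: group_comm_def m_assoc)
    then show ?thesis
      using that normal_conj[OF normal_lower_central] by simp
  qed
  then show ?thesis
    using False
    by (simp add: lower_central_Suc comm_subgroup_def)
       (rule generate_subgroup_incl, auto intro: H.is_subgroup)
qed simp

lemma lower_central_antimono: "k \<le> l \<Longrightarrow> lower_central G l \<subseteq> lower_central G k"
  using lift_Suc_antimono_le[of "lower_central G"] lower_central_Suc_subset by blast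

text \<open>Induction on \<open>l\<close> with \<open>k\<close> free. For a generator
  \<open>(v, x)\<close> of \<open>\<gamma>_{l+1}\<close>, the three subgroups argument reduces
  \<open>(u, (v, x))\<close> to commutators from \<open>(\<gamma>_{k+l}, G)\<close> and
  \<open>(\<gamma>_{k+1}, \<gamma>_l)\<close>.\<close>

lemma group_comm_lower_central:
  assumes "k \<ge> 1" "l \<ge> 1" "a \<in> lower_central G k" "b \<in> lower_central G l"
  shows "group_comm G a b \<in> lower_central G (k + l)"
  using assms(2,1,3,4)
proof (induction l arbitrary: k a b rule: dec_induct)
  case base
  then show ?case
    by (auto simp: lower_central_Suc comm_subgroup_def intro!: generate.incl)
next
  case (step l)
  let ?N = "lower_central G (k + Suc l)"
  have N: "?N \<lhd> G"
    by (rule normal_lower_central)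
  have comm1: "group_comm G u v \<in> lower_central G (Suc j)"
    if "u \<in> lower_central G j" "v \<in> carrier G" "j \<ge> 1" for u v j
    using that by (auto simp: lower_central_Suc comm_subgroup_def intro!: generate.incl)
  have gen: "group_comm G u (group_comm G v x) \<in> ?N"
    if u: "u \<in> lower_central G k" and v: "v \<in> lower_central G l" and x: "x \<in> carrier G" for u v x
  proof -
    have [simp]: "u \<in> carrier G" "v \<in> carrier G"
      using u v lower_central_closed by auto
    have "group_comm G u (inv v) \<in> lower_central G (k + l)"
      using u v step.prems(1) by (intro step.IH lower_central_inv)
    then have "group_comm G (group_comm G u (inv v)) (inv x) \<in> ?N"
      using comm1[of "group_comm G u (inv v)" "k + l" "inv x"] step.prems(1) x by simp
    \<comment> \<open>Here the induction hypothesis is used at \<open>Suc k\<close>, which is why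
      \<open>k\<close> has to be arbitrary.\<close>
    moreover have "group_comm G (group_comm G (inv x) (inv u)) v \<in> ?N"
    proof -
      have "inv (group_comm G (inv u) (inv x)) \<in> lower_central G (Suc k)"
        using u x step.prems(1) by (intro lower_central_inv comm1) auto
      then show ?thesis
        using step.IH[of "Suc k" "group_comm G (inv x) (inv u)" v] v x by (simp add: inv_group_comm)
    qed
    \<comment> \<open>The third letter is \<open>inv x\<close>, so that the conclusion, which
      inverts it, speaks of \<open>x\<close>. The rotation puts the two commutator premises
      first.\<close>
    ultimately have "group_comm G (group_comm G v (inv (inv x))) u \<in> ?N"
      by (rule three_subgroups_elementwise[OF N, rotated 3]) (use x in simp_all)
    then have "inv (group_comm G (group_comm G v x) u) \<in> ?N"
      using x by (intro lower_central_inv) simp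
    then show ?thesis
      using x by (simp add: inv_group_comm)
  qed
  have "lower_central G (Suc l) \<subseteq> {c \<in> carrier G. \<forall>a\<in>lower_central G k. group_comm G a c \<in> ?N}"
    unfolding lower_central_Suc[OF step.hyps(1)] comm_subgroup_def
    by (rule generate_subgroup_incl[OF _ subgroup_group_comm_right[OF lower_central_subset N]])
       (use gen lower_central_closed in auto)
  then show ?case
    using step.prems by auto
qed

lemma group_comm_lower_central_le:
  assumes "k \<ge> 1" "l \<ge> 1" "a \<in> lower_central G k" "b \<in> lower_central G l" "j \<le> k + l"
  shows "group_comm G a b \<in> lower_central G j"
  using group_comm_lower_central[OF assms(1-4)] lower_central_antimono[OF assms(5)] by blast

section \<open>Classes, the graded components and the bracket\<close>

lemma lie_class_eqI:
  assumes "n \<in> lower_central G (Suc k)" "b \<in> carrier G" "a = n \<otimes> b"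
  shows "lie_class G k a = lie_class G k b"
proof -
  interpret N: normal "lower_central G (Suc k)" G by (rule normal_lower_central)
  have "a \<in> lower_central G (Suc k) #> b"
    using assms by (auto simp: r_coset_def)
  then show ?thesis
    unfolding lie_class_def by (rule repr_independence[OF _ assms(2) N.is_subgroup, symmetric])
qed

lemma lie_class_self: "a \<in> carrier G \<Longrightarrow> a \<in> lie_class G k a"
  unfolding lie_class_def
  by (rule rcos_self[OF _ normal_imp_subgroup[OF normal_lower_central]])

lemma lie_classE:
  assumes "b \<in> lie_class G k a"
  obtains n where "n \<in> lower_central G (Suc k)" "b = n \<otimes> a"
  using assms by (auto simp: lie_class_def r_coset_def)

lemma carrier_lie_comp: "carrier (lie_comp G k) = lie_class G k ` lower_central G k"
  by (auto simp: lie_comp_def FactGroup_def RCOSETS_def lie_class_def r_coset_def)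

lemma mult_lie_comp:
  assumes "a \<in> carrier G" "b \<in> carrier G"
  shows "lie_class G k a \<otimes>\<^bsub>lie_comp G k\<^esub> lie_class G k b = lie_class G k (a \<otimes> b)"
proof -
  interpret N: normal "lower_central G (Suc k)" G by (rule normal_lower_central)
  show ?thesis
    using N.rcos_sum[OF assms] by (simp add: lie_comp_def FactGroup_def lie_class_def set_mult_def)
qed

text \<open>Evaluates \<open>lie_bracket\<close> and \<open>square_map\<close> once the value is
  shown to be independent of representatives.\<close>

lemma the_elem_image_const:
  assumes "x \<in> A" "\<And>y. y \<in> A \<Longrightarrow> f y = c"
  shows "the_elem (f ` A) = c"
proof -
  have "f ` A = {c}"
    using assms by auto
  then show ?thesis
    by simp
qed

text \<open>Passing from \<open>a\<close>, \<open>b\<close> to \<open>z \<otimes> a\<close>,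
  \<open>w \<otimes> b\<close> changes the commutator by conjugates of \<open>(z, wb)\<close> and
  \<open>(a, w)\<close>, both in \<open>\<gamma>_{k+l+1}\<close>.\<close>

lemma lie_bracket_lie_class:
  assumes kl: "k \<ge> 1" "l \<ge> 1" and ab: "a \<in> lower_central G k" "b \<in> lower_central G l"
  shows "lie_bracket G k l (lie_class G k a) (lie_class G l b) = lie_class G (k + l) (group_comm G a b)"
  unfolding lie_bracket_def
proof (rule the_elem_image_const[of "(a, b)"], goal_cases)
  case 1
  then show ?case
    using ab lower_central_closed lie_class_self by auto
next
  case (2 p)
  let ?N = "lower_central G (Suc (k + l))"
  interpret N: normal ?N G by (rule normal_lower_central)
  obtain z w where p: "p = (z \<otimes> a, w \<otimes> b)"
    and z: "z \<in> lower_central G (Suc k)" and w: "w \<in> lower_central G (Suc l)"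
    using 2 by (auto elim!: lie_classE)
  have b': "w \<otimes> b \<in> lower_central G l"
    using ab(2) w lower_central_Suc_subset
    by (intro subgroup.m_closed[OF normal_imp_subgroup[OF normal_lower_central]]) auto
  have [simp]: "a \<in> carrier G" "b \<in> carrier G" "z \<in> carrier G" "w \<in> carrier G"
    using ab z w lower_central_closed by auto
  have zb: "group_comm G z (w \<otimes> b) \<in> ?N"
    using group_comm_lower_central_le[of "Suc k" l z "w \<otimes> b"] kl z b' by simp
  have aw: "group_comm G a w \<in> ?N"
    using group_comm_lower_central_le[of k "Suc l" a w] kl ab w by simp
  define n where "n = inv b \<otimes> group_comm G a w \<otimes> b"
  have n: "n \<in> ?N"
    unfolding n_def using aw by (simp add: normal_conj normal_lower_central)
  have "lie_class G (k + l) (group_comm G (z \<otimes> a) (w \<otimes> b)) = lie_class G (k + l) (group_comm G a (w \<otimes> b))"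
    by (rule lie_class_eqI[OF _ _ group_comm_mult_left])
       (use zb in \<open>simp_all add: normal_conj normal_lower_central\<close>)
  also have "\<dots> = lie_class G (k + l) (group_comm G a b)"
  \<comment> \<open>Expanding the right entry leaves the correction \<open>n\<close> on the right;
    conjugation by \<open>(a, b)\<close> carries it to the left.\<close>
  proof (rule lie_class_eqI)
    show "group_comm G a b \<otimes> n \<otimes> inv (group_comm G a b) \<in> ?N"
      using n by (simp add: normal_conj normal_lower_central)
    show "group_comm G a (w \<otimes> b) = group_comm G a b \<otimes> n \<otimes> inv (group_comm G a b) \<otimes> group_comm G a b"
      using n N.subset by (simp add: group_comm_mult_right n_def m_assoc subset_iff)
  qed simp
  finally show ?case
    by (simp add: p)
qed

end

section \<open>Squaring in a group generated by involutions\<close>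

locale involution_generated_group = group +
  fixes S :: "'a set"
  assumes S_closed: "S \<subseteq> carrier G"
    and generate_S: "generate G S = carrier G"
    and S_involution: "s \<in> S \<Longrightarrow> s [^] (2::nat) = \<one>"
begin

lemma square_mem_derived:
  assumes "x \<in> carrier G"
  shows "x [^] (2::nat) \<in> lower_central G 2"
proof -
  interpret N: normal "lower_central G 2" G by (rule normal_lower_central)
  have "generate G S \<subseteq> {c \<in> carrier G. c [^] (2::nat) \<in> lower_central G 2}"
  proof (rule generate_subgroup_incl)
    show "S \<subseteq> {c \<in> carrier G. c [^] (2::nat) \<in> lower_central G 2}"
      using S_closed S_involution by auto
    show "subgroup {c \<in> carrier G. c [^] (2::nat) \<in> lower_central G 2} G"
      using group_comm_lower_central[of 1 1]
      by (intro subgroup_square_mem[OF subgroup_self normal_lower_central]) (simp add: numeral_2_eq_2)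
  qed
  then show ?thesis
    using assms generate_S by auto
qed

lemma square_lower_central:
  assumes "k \<ge> 2" "a \<in> lower_central G k"
  shows "a [^] (2::nat) \<in> lower_central G (Suc k)"
proof -
  obtain j where k: "k = Suc j" and j: "j \<ge> 1"
    using assms(1) by (cases k) auto
  let ?N = "lower_central G (Suc k)"
  interpret N: normal ?N G by (rule normal_lower_central)
  have "lower_central G k \<subseteq> {c \<in> lower_central G k. c [^] (2::nat) \<in> ?N}"
    unfolding k lower_central_Suc[OF j] comm_subgroup_def
  \<comment> \<open>Exposing the generators of \<open>\<gamma>_k\<close> also unfolded its
    occurrence in the target set; the new goals are folded back.\<close>
  proof (rule generate_subgroup_incl, unfold comm_subgroup_def[symmetric] lower_central_Suc[OF j, symmetric] k[symmetric])
    show "subgroup {c \<in> lower_central G k. c [^] (2::nat) \<in> ?N} G"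
      \<comment> \<open>Commutators within \<open>\<gamma>_k\<close> lie in
        \<open>\<gamma>_{2k}\<close>, and \<open>k + 1 \<le> 2k\<close>.\<close>
      by (rule subgroup_square_mem[OF normal_imp_subgroup[OF normal_lower_central] normal_lower_central])
         (rule group_comm_lower_central_le[of k k], use assms(1) in auto)
    have "group_comm G u x [^] (2::nat) \<in> ?N" "group_comm G u x \<in> lower_central G k"
      if u: "u \<in> lower_central G j" and x: "x \<in> carrier G" for u x
    proof -
      have [simp]: "u \<in> carrier G"
        using u lower_central_closed by blast
      define c where "c = group_comm G u x"
      have [simp]: "c \<in> carrier G"
        using x by (simp add: c_def)
      show c: "group_comm G u x \<in> lower_central G k"
        using group_comm_lower_central[of j 1 u x] u x j by (simp add: k)
      define d where "d = c \<otimes> group_comm G x (inv c) \<otimes> inv c"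
      have "inv c \<in> lower_central G k"
        unfolding c_def by (rule lower_central_inv[OF c])
      then have d: "d \<in> ?N"
        unfolding d_def using group_comm_lower_central[of 1 k x "inv c"] x assms(1)
        by (simp add: normal_conj normal_lower_central)
      \<comment> \<open>As the square of \<open>x\<close> lies in \<open>\<gamma>_2\<close>, this
        commutator has depth \<open>j + 2 = k + 1\<close>. It equals \<open>d\<close> times the
        square of \<open>c\<close>, and \<open>d\<close> is already in \<open>?N\<close>.\<close>
      have "group_comm G u (x [^] (2::nat)) \<in> ?N"
        using group_comm_lower_central[of j 2 u] u j square_mem_derived[OF x] by (simp add: k)
      then have "d \<otimes> c [^] (2::nat) \<in> ?N"
        using group_comm_square_right[of u x] x by (simp add: c_def d_def)
      then have "inv d \<otimes> (d \<otimes> c [^] (2::nat)) \<in> ?N"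
        using d by blast
      then show "group_comm G u x [^] (2::nat) \<in> ?N"
        using lower_central_closed[OF d] x by (simp add: mult_inv_cancel_left c_def)
    qed
    then show "{group_comm G a b |a b. a \<in> lower_central G j \<and> b \<in> carrier G}
      \<subseteq> {c \<in> lower_central G k. c [^] (2::nat) \<in> ?N}"
      by auto
  qed
  then show ?thesis
    using assms(2) by auto
qed

text \<open>The correction in \<open>square_mult\<close> lies in \<open>\<gamma>_{2k}\<close>; the
  bound \<open>k \<ge> 2\<close> gives \<open>2k \<ge> k + 2\<close>.\<close>

lemma lie_class_square_mult:
  assumes "k \<ge> 2" "a \<in> lower_central G k" "b \<in> lower_central G k"
  shows "lie_class G (Suc k) ((a \<otimes> b) [^] (2::nat)) = lie_class G (Suc k) (a [^] (2::nat) \<otimes> b [^] (2::nat))"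
proof (rule lie_class_eqI)
  interpret H: normal "lower_central G k" G by (rule normal_lower_central)
  have "group_comm G (inv b) (inv a) \<in> lower_central G (Suc (Suc k))"
    using assms by (intro group_comm_lower_central_le[of k k]) auto
  then show "a \<otimes> group_comm G (inv b) (inv a) \<otimes> inv a \<in> lower_central G (Suc (Suc k))"
    using assms by (simp add: normal_conj normal_lower_central)
qed (use assms lower_central_closed square_mult in auto)

text \<open>Another representative is \<open>z \<otimes> a\<close> with \<open>z\<close> in
  \<open>\<gamma>_{k+1}\<close>; its square splits modulo \<open>\<gamma>_{k+2}\<close>, where the
  square of \<open>z\<close> vanishes.\<close>

lemma square_map_lie_class:
  assumes k: "k \<ge> 2" and a: "a \<in> lower_central G k"
  shows "square_map G k (lie_class G k a) = lie_class G (Suc k) (a [^] (2::nat))"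
  unfolding square_map_def
proof (rule the_elem_image_const)
  have [simp]: "a \<in> carrier G"
    using a lower_central_closed by blast
  then show "a \<in> lie_class G k a"
    by (rule lie_class_self)
  fix y assume "y \<in> lie_class G k a"
  then obtain z where z: "z \<in> lower_central G (Suc k)" and y: "y = z \<otimes> a"
    by (rule lie_classE)
  have "z \<in> lower_central G k"
    using z lower_central_Suc_subset by blast
  then have "lie_class G (Suc k) (y [^] (2::nat)) = lie_class G (Suc k) (z [^] (2::nat) \<otimes> a [^] (2::nat))"
    using k a by (simp add: y lie_class_square_mult)
  also have "\<dots> = lie_class G (Suc k) (a [^] (2::nat))"
    by (rule lie_class_eqI[of "z [^] (2::nat)"]) (use square_lower_central[OF _ z] k in auto)
  finally show "lie_class G (Suc k) (y [^] (2::nat)) = lie_class G (Suc k) (a [^] (2::nat))" .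
qed

lemma square_map_hom:
  assumes k: "k \<ge> 2"
  shows "square_map G k \<in> hom (lie_comp G k) (lie_comp G (Suc k))"
proof -
  interpret H: normal "lower_central G k" G by (rule normal_lower_central)
  show ?thesis
    using k by (auto simp: hom_def carrier_lie_comp square_map_lie_class square_lower_central
        mult_lie_comp lie_class_square_mult)
qed

text \<open>For \<open>c = (a, b)\<close>, the element \<open>(a, b^2)\<close> differs from
  \<open>c^2\<close> by a conjugate of \<open>(b, inv c)\<close>. This lies in
  \<open>\<gamma>_{k+2l}\<close>, and \<open>l \<ge> 2\<close> gives
  \<open>k + 2l \<ge> k + l + 2\<close>.\<close>

lemma lie_bracket_square_map:
  assumes k: "k \<ge> 1" and l: "l \<ge> 2" and x: "x \<in> carrier (lie_comp G k)" and y: "y \<in> carrier (lie_comp G l)"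
  shows "lie_bracket G k (Suc l) x (square_map G l y) = square_map G (k + l) (lie_bracket G k l x y)"
proof -
  obtain a b where a: "a \<in> lower_central G k" "x = lie_class G k a"
    and b: "b \<in> lower_central G l" "y = lie_class G l b"
    using x y by (auto simp: carrier_lie_comp)
  have [simp]: "a \<in> carrier G" "b \<in> carrier G"
    using a b lower_central_closed by auto
  define c where "c = group_comm G a b"
  have [simp]: "c \<in> carrier G"
    by (simp add: c_def)
  have c: "c \<in> lower_central G (k + l)"
    unfolding c_def using a b k l by (intro group_comm_lower_central) auto
  then have "inv c \<in> lower_central G (k + l)"
    by (rule lower_central_inv)
  then have "group_comm G b (inv c) \<in> lower_central G (Suc (Suc (k + l)))"
    using b k l by (intro group_comm_lower_central_le[of l "k + l"]) auto
  then have "lie_class G (Suc (k + l)) (group_comm G a (b [^] (2::nat)))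
      = lie_class G (Suc (k + l)) (c [^] (2::nat))"
    by (intro lie_class_eqI[OF _ _ group_comm_square_right[of a b, folded c_def]])
       (simp_all add: normal_conj normal_lower_central)
  then show ?thesis
    using a b k l c square_lower_central[OF l b(1)]
    by (simp add: square_map_lie_class lie_bracket_lie_class flip: c_def)
qed

text \<open>Both entries have degree 1, outside the range of \<open>lie_bracket_square_map\<close>.
  Instead the representatives of the two sides agree exactly in \<open>G\<close>, by
  \<open>group_comm_involutions\<close>.\<close>

lemma square_map_lie_bracket_generators:
  assumes x: "x \<in> S" and y: "y \<in> S"
  shows "square_map G 2 (lie_bracket G 1 1 (lie_class G 1 x) (lie_class G 1 y)) =
    lie_bracket G 1 2 (lie_class G 1 x) (lie_bracket G 1 1 (lie_class G 1 x) (lie_class G 1 y))"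
proof -
  have xy: "x \<in> carrier G" "y \<in> carrier G"
    using x y S_closed by auto
  then have "group_comm G x y \<in> lower_central G 2"
    using group_comm_lower_central[of 1 1 x y] by (simp add: numeral_2_eq_2)
  then show ?thesis
    using xy lie_bracket_lie_class[of 1 1 x y] lie_bracket_lie_class[of 1 2 x "group_comm G x y"]
      square_map_lie_class[of 2 "group_comm G x y"] group_comm_involutions[OF xy S_involution[OF x] S_involution[OF y]]
    by (simp add: numeral_2_eq_2)
qed

end

theorem theorem3p5:
  fixes G :: "('a, 'b) monoid_scheme" and g :: "nat \<Rightarrow> 'a" and m :: nat
  assumes "group G"
    and "g ` {1..m} \<subseteq> carrier G"
    and "generate G (g ` {1..m}) = carrier G"
    and "\<forall>i\<in>{1..m}. g i [^]\<^bsub>G\<^esub> (2::nat) = \<one>\<^bsub>G\<^esub>"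
  shows "(\<forall>k\<ge>2.
            (\<forall>a\<in>lower_central G k. a [^]\<^bsub>G\<^esub> (2::nat) \<in> lower_central G (k + 1)) \<and>
            (\<forall>a\<in>lower_central G k. \<forall>b\<in>lower_central G k. lie_class G k a = lie_class G k b \<longrightarrow>
               lie_class G (k + 1) (a [^]\<^bsub>G\<^esub> (2::nat)) = lie_class G (k + 1) (b [^]\<^bsub>G\<^esub> (2::nat))) \<and>
            (\<forall>a\<in>lower_central G k.
               square_map G k (lie_class G k a) = lie_class G (k + 1) (a [^]\<^bsub>G\<^esub> (2::nat))) \<and>
            square_map G k \<in> hom (lie_comp G k) (lie_comp G (k + 1)))
       \<and> (\<forall>k\<ge>1. \<forall>l\<ge>2. \<forall>x\<in>carrier (lie_comp G k). \<forall>y\<in>carrier (lie_comp G l).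
            lie_bracket G k (l + 1) x (square_map G l y) = square_map G (k + l) (lie_bracket G k l x y))
       \<and> (\<forall>i\<in>{1..m}. \<forall>l\<ge>2. \<forall>y\<in>carrier (lie_comp G l).
            square_map G (1 + l) (lie_bracket G 1 l (lie_class G 1 (g i)) y) =
            lie_bracket G 1 (l + 1) (lie_class G 1 (g i)) (square_map G l y))
       \<and> (\<forall>i\<in>{1..m}. \<forall>j\<in>{1..m}.
            square_map G 2 (lie_bracket G 1 1 (lie_class G 1 (g i)) (lie_class G 1 (g j))) =
            lie_bracket G 1 2 (lie_class G 1 (g i))
              (lie_bracket G 1 1 (lie_class G 1 (g i)) (lie_class G 1 (g j))))"
proof -
  interpret involution_generated_group G "g ` {1..m}"
    using assms by (simp add: involution_generated_group_def involution_generated_group_axioms_def) auto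
  have gen: "lie_class G 1 (g i) \<in> carrier (lie_comp G 1)" if "i \<in> {1..m}" for i
    using that assms(2) unfolding carrier_lie_comp by (intro imageI) auto
  show ?thesis
    unfolding Suc_eq_plus1[symmetric]
  proof (intro conjI ballI allI impI, goal_cases)
    case (1 k a)
    then show ?case by (rule square_lower_central)
  next
    case (2 k a b)
    \<comment> \<open>Both sides are the value of \<open>square_map\<close> at the common
      class.\<close>
    then show ?case by (metis square_map_lie_class)
  next
    case (3 k a)
    then show ?case by (rule square_map_lie_class)
  next
    case (4 k)
    then show ?case by (rule square_map_hom)
  next
    case (5 k l x y)
    then show ?case by (rule lie_bracket_square_map)
  next
    case (6 i l y)
    then show ?case using lie_bracket_square_map[OF _ _ gen] by auto
  next
    case (7 i j)
    then show ?case by (intro square_map_lie_bracket_generators) auto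
  qed
qed

end
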